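(* Let $\lambda$ be an integer partition. Then $c^{\lambda}_{sp}(u)\neq 0$ for every cell $u\in\lambda$ if and only if either $\lambda=\emptyset$, or every nested hook $(a,1^b)$ of $\lambda$ satisfies $a=b$.
   Context: A partition $\lambda=(\lambda_1\ge\lambda_2\ge\cdots\ge\lambda_\ell>0)$ is identified with its Young diagram; cell $(i,j)$ lies in row $i$ and column $j$, and $\lambda'$ denotes the conjugate partition (so $\lambda'_j$ is the length of column $j$; $\lambda_i=0$ for $i>\ell$). The symplectic content of a cell $(i,j)\in\lambda$ is $c^\lambda_{sp}(i,j)=\lambda_i+\lambda_j-i-j+2$ if $i>j$, and $c^\lambda_{sp}(i,j)=i+j-\lambda'_i-\lambda'_j$ if $i\le j$. The notation $(a,1^b)$ denotes the hook partition with one part $a$ followed by $b$ parts equal to $1$. The $i$-th nested hook of $\lambda$ (for $i$ at most the side length of the Durfee square, i.e. the number of $i$ with $\lambda_i\ge i$) is the hook partition $(\lambda_i-i+1,1^{\lambda'_i-i})$, consisting of the diagonal cell $(i,i)$ and all cells of $\lambda$ directly to its right and directly below it. *)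

theory Defs
  imports Main
begin

text \<open>
  A partition is the weakly decreasing list of its (positive) parts; rows and columns of the
  Young diagram are numbered from 1.
\<close>

definition is_partition :: "nat list \<Rightarrow> bool" where
  "is_partition lam \<longleftrightarrow> sorted_wrt (\<ge>) lam \<and> (\<forall>x\<in>set lam. 0 < x)"

text \<open>The part \<open>lam\<^sub>i\<close> for \<open>i \<ge> 1\<close>, extended by 0 beyond the length; the value at index 0 is junk.\<close>

definition part :: "nat list \<Rightarrow> nat \<Rightarrow> nat" where
  "part lam i = (if 1 \<le> i \<and> i \<le> length lam then lam ! (i - 1) else 0)"

definition cells :: "nat list \<Rightarrow> (nat \<times> nat) set" where
  "cells lam = {(i, j). 1 \<le> i \<and> 1 \<le> j \<and> j \<le> part lam i}"

text \<open>The \<open>j\<close>-th part of the conjugate partition, i.e. the length of column \<open>j\<close>.\<close>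

definition conj_part :: "nat list \<Rightarrow> nat \<Rightarrow> nat" where
  "conj_part lam j = card {i. (i, j) \<in> cells lam}"

fun sp_content :: "nat list \<Rightarrow> nat \<times> nat \<Rightarrow> int" where
  "sp_content lam (i, j) =
     (if i > j then int (part lam i) + int (part lam j) - int i - int j + 2
      else int i + int j - int (conj_part lam i) - int (conj_part lam j))"

definition hook :: "nat \<Rightarrow> nat \<Rightarrow> nat list" where
  "hook a b = a # replicate b 1"

definition durfee :: "nat list \<Rightarrow> nat" where
  "durfee lam = card {i. 1 \<le> i \<and> i \<le> part lam i}"

text \<open>
  Only meant for \<open>1 \<le> i \<le> durfee lam\<close>; then \<open>i \<le> part lam i\<close> and \<open>i \<le> conj_part lam i\<close>, so
  neither subtraction truncates.
\<close>

definition nested_hook :: "nat list \<Rightarrow> nat \<Rightarrow> nat list" where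
  "nested_hook lam i = hook (part lam i - i + 1) (conj_part lam i - i)"

definition nested_hooks :: "nat list \<Rightarrow> nat list set" where
  "nested_hooks lam = nested_hook lam ` {1..durfee lam}"

end

theory Submission
  imports Defs
begin

text \<open>
  Write \<open>C\<^sub>i\<close> for the length of column \<open>i\<close> and \<open>d\<close> for the Durfee side. A nested hook is
  balanced iff \<open>C\<^sub>i = lam\<^sub>i + 1\<close>. If this holds for all \<open>i \<le> d\<close>, then contents are negative
  on and above the diagonal and positive below it. Conversely, let \<open>i \<le> d\<close> be the largest
  index with \<open>C\<^sub>i \<noteq> lam\<^sub>i + 1\<close>. If \<open>C\<^sub>i \<le> lam\<^sub>i\<close>, then the column \<open>j = C\<^sub>i\<close> has length \<open>i\<close>, so
  the cell \<open>(i, j)\<close> has content 0; if \<open>C\<^sub>i \<ge> lam\<^sub>i + 2\<close>, then the row \<open>r = lam\<^sub>i + 2\<close> has length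
  \<open>i\<close>, so the cell \<open>(r, i)\<close> has content 0.
\<close>

text \<open>Turns the cardinalities defining \<open>conj_part\<close> and \<open>durfee\<close> into
  membership tests.\<close>

lemma down_closed_eq_atLeastAtMost_card:
  fixes S :: "nat set"
  assumes fin: "finite S" and pos: "0 \<notin> S"
    and down: "\<And>i k. i \<in> S \<Longrightarrow> 1 \<le> k \<Longrightarrow> k \<le> i \<Longrightarrow> k \<in> S"
  shows "S = {1..card S}"
proof (cases "S = {}")
  case False
  have "S = {1..Max S}"
  proof (rule set_eqI)
    fix k
    have "Max S \<in> S" using False fin by simp
    then show "k \<in> S \<longleftrightarrow> k \<in> {1..Max S}"
      using fin pos down[of "Max S" k] by (cases k) auto
  qed
  then show ?thesis by (metis card_atLeastAtMost diff_Suc_1)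
qed simp

lemma part_antimono:
  assumes "is_partition lam" "1 \<le> i" "i \<le> k"
  shows "part lam k \<le> part lam i"
proof (cases "i = k")
  case False
  then show ?thesis
    using assms by (auto simp: part_def is_partition_def sorted_wrt_iff_nth_less)
qed simp

lemma part_pos_imp_le_length: "0 < part lam i \<Longrightarrow> i \<le> length lam"
  by (auto simp: part_def split: if_splits)

text \<open>Both sides say that (i, j) is a cell: parts decrease, so the rows meeting column j form
  an initial segment, of length \<open>conj_part lam j\<close>.\<close>

lemma le_part_iff_le_conj_part:
  assumes "is_partition lam" "1 \<le> i" "1 \<le> j"
  shows "j \<le> part lam i \<longleftrightarrow> i \<le> conj_part lam j"
proof -
  let ?S = "{i. (i, j) \<in> cells lam}"
  have "?S = {1..card ?S}"
  proof (rule down_closed_eq_atLeastAtMost_card)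
    show "finite ?S"
      by (rule finite_subset[of _ "{..length lam}"])
        (auto simp: cells_def intro!: part_pos_imp_le_length)
    show "k \<in> ?S" if "i \<in> ?S" "1 \<le> k" "k \<le> i" for i k
      using that part_antimono[OF assms(1), of k i] by (auto simp: cells_def)
  qed (simp add: cells_def)
  then have "i \<in> ?S \<longleftrightarrow> i \<in> {1..conj_part lam j}"
    unfolding conj_part_def by blast
  then show ?thesis using assms by (simp add: cells_def)
qed

lemma conj_part_antimono:
  assumes "is_partition lam" "1 \<le> i" "i \<le> k"
  shows "conj_part lam k \<le> conj_part lam i"
proof (cases "conj_part lam k = 0")
  case False
  then show ?thesis
    using assms le_part_iff_le_conj_part[OF assms(1), of "conj_part lam k" k]
      le_part_iff_le_conj_part[OF assms(1), of "conj_part lam k" i] by simp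
qed simp

text \<open>The diagonal indices form an initial segment: from k \<le> i and
  \<open>i \<le> part lam i\<close> follows \<open>k \<le> part lam k\<close>, again because parts
  decrease.\<close>

lemma le_durfee_iff:
  assumes "is_partition lam" "1 \<le> i"
  shows "i \<le> durfee lam \<longleftrightarrow> i \<le> part lam i"
proof -
  let ?S = "{i. 1 \<le> i \<and> i \<le> part lam i}"
  have "?S = {1..card ?S}"
  proof (rule down_closed_eq_atLeastAtMost_card)
    show "finite ?S"
      by (rule finite_subset[of _ "{..length lam}"]) (auto intro!: part_pos_imp_le_length)
    show "k \<in> ?S" if "i \<in> ?S" "1 \<le> k" "k \<le> i" for i k
      using that part_antimono[OF assms(1), of k i] by simp
  qed simp
  then have "i \<in> ?S \<longleftrightarrow> i \<in> {1..durfee lam}"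
    unfolding durfee_def by blast
  then show ?thesis using assms by simp
qed

lemma hook_eq_iff: "hook a b = hook a' b' \<longleftrightarrow> a = a' \<and> b = b'"
  unfolding hook_def by (metis length_replicate list.inject)

lemma nested_hooks_balanced_iff:
  assumes "is_partition lam"
  shows "(\<forall>a b. hook a b \<in> nested_hooks lam \<longrightarrow> a = b) \<longleftrightarrow>
         (\<forall>i. 1 \<le> i \<and> i \<le> part lam i \<longrightarrow> conj_part lam i = part lam i + 1)"
proof -
  have "(\<forall>a b. hook a b \<in> nested_hooks lam \<longrightarrow> a = b) \<longleftrightarrow>
        (\<forall>i\<in>{1..durfee lam}. part lam i - i + 1 = conj_part lam i - i)"
    by (auto simp: nested_hooks_def nested_hook_def hook_eq_iff)
  also have "\<dots> \<longleftrightarrow>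
        (\<forall>i. 1 \<le> i \<and> i \<le> part lam i \<longrightarrow> part lam i - i + 1 = conj_part lam i - i)"
    using le_durfee_iff[OF assms] by auto
  also have "\<dots> \<longleftrightarrow>
        (\<forall>i. 1 \<le> i \<and> i \<le> part lam i \<longrightarrow> conj_part lam i = part lam i + 1)"
  proof -
    have "part lam i - i + 1 = conj_part lam i - i \<longleftrightarrow> conj_part lam i = part lam i + 1"
      if "1 \<le> i" "i \<le> part lam i" for i
      \<comment> \<open>The diagonal cell (i, i) gives \<open>i \<le> conj_part lam i\<close>, so
        neither subtraction truncates.\<close>
      using that le_part_iff_le_conj_part[OF assms, of i i] by auto
    then show ?thesis by blast
  qed
  finally show ?thesis .
qed

lemma sp_content_nonzero_if_balanced:
  assumes lam: "is_partition lam"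
    and bal: "\<And>i. 1 \<le> i \<Longrightarrow> i \<le> part lam i \<Longrightarrow> conj_part lam i = part lam i + 1"
    and cell: "(i, j) \<in> cells lam"
  shows "sp_content lam (i, j) \<noteq> 0"
proof -
  have ij: "1 \<le> i" "1 \<le> j" "j \<le> part lam i" using cell by (auto simp: cells_def)
  then have col: "i \<le> conj_part lam j" using le_part_iff_le_conj_part[OF lam] by blast
  show ?thesis
  proof (cases "i > j")
    case True
    then have "j \<le> part lam j" using ij part_antimono[OF lam, of j i] by simp
    then have "conj_part lam j = part lam j + 1" using bal ij by blast
    \<comment> \<open>Here \<open>part lam j \<ge> i - 1\<close> and
      \<open>part lam i \<ge> j\<close>, so the content is at least 1.\<close>
    then show ?thesis using True ij col by simp
  next
    case False
    then have "conj_part lam i = part lam i + 1" using bal ij by simp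
    \<comment> \<open>Here \<open>conj_part lam i \<ge> j + 1\<close> and
      \<open>conj_part lam j \<ge> i\<close>, so the content is at most -1.\<close>
    then show ?thesis using False ij col by simp
  qed
qed

text \<open>One step of the descent along the diagonal. Since \<open>next_bal\<close> is
  conditional, the last diagonal index is covered too.\<close>

lemma balanced_at_if_balanced_at_Suc:
  assumes lam: "is_partition lam"
    and nonzero: "\<And>u. u \<in> cells lam \<Longrightarrow> sp_content lam u \<noteq> 0"
    and i: "1 \<le> i" "i \<le> part lam i"
    and next_bal: "i + 1 \<le> part lam (i + 1) \<Longrightarrow>
                   conj_part lam (i + 1) = part lam (i + 1) + 1"
  shows "conj_part lam i = part lam i + 1"
proof (rule ccontr)
  assume neq: "conj_part lam i \<noteq> part lam i + 1"
  note dual = le_part_iff_le_conj_part[OF lam]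
  have col: "i \<le> conj_part lam i" using dual i by blast
  show False
  proof (cases "conj_part lam i \<le> part lam i")
    case True
    define j where "j = conj_part lam i"
    have j: "i \<le> j" "1 \<le> j" "j \<le> part lam i" using True col i by (auto simp: j_def)
    have "conj_part lam j \<le> i"
    proof (rule ccontr)
      assume "\<not> conj_part lam j \<le> i"
      then have le: "j \<le> part lam (i + 1)" using dual[of "i + 1" j] j by simp
      show False
      \<comment> \<open>If (i+1, i+1) is a cell, balance there makes column i+1 longer than column
        i. Otherwise j = i, and the cell (i+1, i) contradicts column i having length j.\<close>
      proof (cases "i + 1 \<le> part lam (i + 1)")
        case True
        then show False
          using next_bal le conj_part_antimono[OF lam i(1), of "i + 1"] by (simp add: j_def)
      next
        case False
        then have "j = i" "i \<le> part lam (i + 1)" using le j by auto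
        then show False using dual[of "i + 1" i] i by (simp add: j_def)
      qed
    qed
    moreover have "i \<le> conj_part lam j" using dual i j by blast
    ultimately have "sp_content lam (i, j) = 0" using j by (simp add: j_def)
    moreover have "(i, j) \<in> cells lam" using i j by (simp add: cells_def)
    ultimately show False using nonzero by blast
  next
    case False
    define r where "r = part lam i + 2"
    have r: "r \<le> conj_part lam i" "i < r" "1 \<le> r" using False neq i by (auto simp: r_def)
    have "part lam r \<le> i"
    proof (rule ccontr)
      assume "\<not> part lam r \<le> i"
      then have le: "r \<le> conj_part lam (i + 1)" using dual[of r "i + 1"] r by simp
      then have "i + 1 \<le> part lam (i + 1)"
        using dual[of "i + 1" "i + 1"] r by simp
      \<comment> \<open>Balance at i+1 gives \<open>part lam (i + 1) \<ge> r - 1\<close>, which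
        exceeds \<open>part lam i\<close>.\<close>
      then show False
        using next_bal le part_antimono[OF lam i(1), of "i + 1"] by (simp add: r_def)
    qed
    moreover have row: "i \<le> part lam r" using dual i r by blast
    ultimately have "sp_content lam (r, i) = 0" using r by (simp add: r_def)
    moreover have "(r, i) \<in> cells lam" using i r row by (simp add: cells_def)
    ultimately show False using nonzero by blast
  qed
qed

text \<open>Downward induction on i, starting from the Durfee side.\<close>

lemma balanced_if_sp_content_nonzero:
  assumes lam: "is_partition lam"
    and nonzero: "\<And>u. u \<in> cells lam \<Longrightarrow> sp_content lam u \<noteq> 0"
    and "1 \<le> i" "i \<le> part lam i"
  shows "conj_part lam i = part lam i + 1"
  using assms(3,4)
proof (induction "durfee lam - i" arbitrary: i rule: less_induct)
  case less
  have "conj_part lam (i + 1) = part lam (i + 1) + 1" if "i + 1 \<le> part lam (i + 1)"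
  proof (rule less.hyps)
    have "i + 1 \<le> durfee lam" using that le_durfee_iff[OF lam, of "i + 1"] by simp
    then show "durfee lam - (i + 1) < durfee lam - i" by simp
  qed (use that in simp_all)
  then show ?case using balanced_at_if_balanced_at_Suc[OF lam nonzero less.prems] by blast
qed

theorem theorem1p5:
  fixes lam :: "nat list"
  assumes "is_partition lam"
  shows "(\<forall>u\<in>cells lam. sp_content lam u \<noteq> 0) \<longleftrightarrow>
         (lam = [] \<or> (\<forall>a b. hook a b \<in> nested_hooks lam \<longrightarrow> a = b))"
proof -
  have "(\<forall>u\<in>cells lam. sp_content lam u \<noteq> 0) \<longleftrightarrow>
        (\<forall>i. 1 \<le> i \<and> i \<le> part lam i \<longrightarrow> conj_part lam i = part lam i + 1)"
    using balanced_if_sp_content_nonzero[OF assms] sp_content_nonzero_if_balanced[OF assms]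
    by (metis surj_pair)
  \<comment> \<open>The empty partition satisfies the content condition vacuously.\<close>
  moreover have "lam = [] \<Longrightarrow> cells lam = {}"
    by (auto simp: cells_def part_def)
  ultimately show ?thesis
    using nested_hooks_balanced_iff[OF assms] by blast
qed

end
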